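(* Let $R$ be a rational knot whose determinant is an odd prime $p$. Then any non-trivial $p$-coloring of any Schubert Normal Form of $R$ uses all $p$ available colors, i.e., every integer modulo $p$ is the color of at least one arc.
   Context: Rational knots are the $2$-bridge knots, i.e., knots admitting diagrams with exactly two over-arcs (bridges). A Schubert Normal Form (SNF) of a (non-trivial) rational link is the standard $2$-bridge diagram of Schubert (Math. Z. 65 (1956)): it consists of two disjoint embedded segments in the plane (the bridges) and two disjoint embedded curves (the under-strands) joining the endpoints of the bridges, such that every crossing is one of an under-strand passing under the interior of a bridge; traveling along an under-strand starting from an end of a bridge, one first passes under the other bridge and thereafter passes under the two bridges alternately; and traveling along each bridge, one meets the two under-strands alternately. For an integer $p>1$, a $p$-coloring of a link diagram is an assignment of integers modulo $p$ (colors) to the arcs of the diagram such that at each crossing, twice the color of the over-arc equals the sum of the colors of the two under-arcs, modulo $p$; it is non-trivial if it uses more than one color. *)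

theory Defs
  imports
    "HOL-Analysis.Analysis"
    "HOL-Number_Theory.Cong"
    "HOL-Computational_Algebra.Primes"
    "Jordan_Normal_Form.Determinant"
begin

text \<open>
  Three-space is \<^typ>\<open>complex \<times> real\<close>: the first component is the plane of projection, the second
  one the height.
\<close>

type_synonym space = "complex \<times> real"

definition is_knot :: "space set \<Rightarrow> bool" where
  "is_knot K \<longleftrightarrow> (\<exists>g. simple_path g \<and> pathfinish g = pathstart g \<and> path_image g = K)"

definition is_link :: "space set \<Rightarrow> bool" where
  "is_link L \<longleftrightarrow>
     (\<exists>C. finite C \<and> C \<noteq> {} \<and> (\<forall>K\<in>C. is_knot K) \<and> pairwise disjnt C \<and> L = \<Union>C)"

definition ambient_isotopic :: "space set \<Rightarrow> space set \<Rightarrow> bool" where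
  "ambient_isotopic A B \<longleftrightarrow>
     (\<exists>H :: real \<Rightarrow> space \<Rightarrow> space.
        continuous_on ({0..1} \<times> UNIV) (\<lambda>(t, x). H t x) \<and>
        (\<forall>t\<in>{0..1}. \<exists>G. homeomorphism UNIV UNIV (H t) G) \<and>
        (\<forall>x. H 0 x = x) \<and> H 1 ` A = B)"

text \<open>
  A link diagram is represented by a link in general position with respect to the vertical
  projection \<^const>\<open>fst\<close>.  The plane picture is the image of that projection, and the heights over a
  double point tell which strand passes over; the actual heights play no other role.
\<close>

definition crossings :: "space set \<Rightarrow> complex set" where
  "crossings D = {z. \<exists>h k. k < h \<and> (z, h) \<in> D \<and> (z, k) \<in> D}"

definition over_points :: "space set \<Rightarrow> space set" where
  "over_points D = {(z, h). (z, h) \<in> D \<and> (\<exists>k<h. (z, k) \<in> D)}"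

definition under_points :: "space set \<Rightarrow> space set" where
  "under_points D = {(z, k). (z, k) \<in> D \<and> (\<exists>h>k. (z, h) \<in> D)}"

text \<open>
  Near a transverse double point and in suitable topological coordinates \<^term>\<open>\<phi>\<close> of the plane, the
  link consists of a strand over the real axis and a lower strand over the imaginary axis.
\<close>

definition transverse_crossing :: "space set \<Rightarrow> complex \<Rightarrow> bool" where
  "transverse_crossing D z \<longleftrightarrow>
     (\<exists>V \<phi> \<psi> (a :: real \<Rightarrow> real) (b :: real \<Rightarrow> real).
        open V \<and> homeomorphism UNIV V \<phi> \<psi> \<and> \<phi> 0 = z \<and>
        continuous_on UNIV a \<and> continuous_on UNIV b \<and> b 0 < a 0 \<and>
        D \<inter> (V \<times> UNIV) =
          range (\<lambda>t. (\<phi> (of_real t), a t)) \<union> range (\<lambda>t. (\<phi> (\<i> * of_real t), b t)))"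

definition link_diagram :: "space set \<Rightarrow> bool" where
  "link_diagram D \<longleftrightarrow>
     is_link D \<and> finite (crossings D) \<and> (\<forall>z\<in>crossings D. transverse_crossing D z)"

definition diagram_of :: "space set \<Rightarrow> space set \<Rightarrow> bool" where
  "diagram_of D K \<longleftrightarrow> link_diagram D \<and> ambient_isotopic K D"

definition diagram_arcs :: "space set \<Rightarrow> space set set" where
  "diagram_arcs D = components (D - under_points D)"

text \<open>
  At the crossing \<^term>\<open>z\<close>, \<^term>\<open>Q\<close> is the over-arc and \<^term>\<open>A\<close>, \<^term>\<open>B\<close> are the two under-arcs.  The
  latter are found by following the under-strand from one side of the crossing to the other along
  an injective path that runs through no other under-crossing; they may coincide with each other
  or with \<^term>\<open>Q\<close>, and they occur in both orders.
\<close>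

definition arcs_at :: "space set \<Rightarrow> complex \<Rightarrow> space set \<Rightarrow> space set \<Rightarrow> space set \<Rightarrow> bool" where
  "arcs_at D z Q A B \<longleftrightarrow>
     Q \<in> diagram_arcs D \<and> A \<in> diagram_arcs D \<and> B \<in> diagram_arcs D \<and>
     (\<exists>h k g. k < h \<and> (z, h) \<in> Q \<and> (z, k) \<in> D \<and>
        arc g \<and> path_image g \<subseteq> D \<and> path_image g \<inter> under_points D = {(z, k)} \<and>
        pathstart g \<in> A \<and> pathfinish g \<in> B)"

text \<open>Colors are integers, to be read modulo \<^term>\<open>p\<close>.\<close>

definition coloring :: "nat \<Rightarrow> space set \<Rightarrow> (space set \<Rightarrow> int) \<Rightarrow> bool" where
  "coloring p D c \<longleftrightarrow>
     (\<forall>z\<in>crossings D. \<forall>Q A B. arcs_at D z Q A B \<longrightarrow> [2 * c Q = c A + c B] (mod int p))"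

definition nontrivial_coloring :: "nat \<Rightarrow> space set \<Rightarrow> (space set \<Rightarrow> int) \<Rightarrow> bool" where
  "nontrivial_coloring p D c \<longleftrightarrow>
     coloring p D c \<and>
     (\<exists>A\<in>diagram_arcs D. \<exists>B\<in>diagram_arcs D. \<not> [c A = c B] (mod int p))"

definition bridges :: "space set \<Rightarrow> space set set" where
  "bridges D = {A \<in> diagram_arcs D. A \<inter> over_points D \<noteq> {}}"

definition rational_knot :: "space set \<Rightarrow> bool" where
  "rational_knot K \<longleftrightarrow> is_knot K \<and> (\<exists>D. diagram_of D K \<and> card (bridges D) = 2)"

text \<open>
  The coefficient matrix of the system of coloring equations has one row for each crossing and one
  column for each arc.  A knot diagram with a crossing has as many arcs as crossings, and any first
  minor of the matrix gives, up to sign, the determinant of the knot.  Since the enumerations of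
  crossings and arcs are arbitrary, it is no restriction to delete the last row and the last
  column.  A diagram without crossings has one arc and the empty minor, which is 1.
\<close>

definition coloring_coeff :: "space set \<Rightarrow> complex \<Rightarrow> space set \<Rightarrow> int" where
  "coloring_coeff D z X =
     (THE v. \<exists>Q A B. arcs_at D z Q A B \<and>
        v = 2 * of_bool (X = Q) - of_bool (X = A) - of_bool (X = B))"

definition first_minor :: "space set \<Rightarrow> int \<Rightarrow> bool" where
  "first_minor D m \<longleftrightarrow>
     (\<exists>row col.
        bij_betw row {..<card (crossings D)} (crossings D) \<and>
        bij_betw col {..<card (diagram_arcs D)} (diagram_arcs D) \<and>
        m = Determinant.det
              (Matrix.mat (card (diagram_arcs D) - 1) (card (diagram_arcs D) - 1)
                 (\<lambda>(i, j). coloring_coeff D (row i) (col j))))"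

definition knot_determinant :: "space set \<Rightarrow> nat" where
  "knot_determinant K =
     (THE d. \<exists>D m. diagram_of D K \<and> first_minor D m \<and> d = nat \<bar>m\<bar>)"

text \<open>
  \<^term>\<open>g\<close> is a path in the plane.  The parameters 0 and 1 are disregarded because the
  under-strands and the bridges share their end points, which are not crossings.
\<close>

definition first_meets :: "(real \<Rightarrow> complex) \<Rightarrow> complex set \<Rightarrow> complex set \<Rightarrow> bool" where
  "first_meets g P Q \<longleftrightarrow>
     (\<exists>t\<in>{0<..<1}. g t \<in> P \<and> (\<forall>s\<in>{0<..<t}. g s \<notin> P \<union> Q))"

definition meets_alternately :: "(real \<Rightarrow> complex) \<Rightarrow> complex set \<Rightarrow> complex set \<Rightarrow> bool" where
  "meets_alternately g P Q \<longleftrightarrow>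
     (\<forall>s t. 0 < s \<and> s < t \<and> t < 1 \<and> g s \<in> P \<union> Q \<and> g t \<in> P \<union> Q \<and>
        (\<forall>r\<in>{s<..<t}. g r \<notin> P \<union> Q) \<longrightarrow>
        (g s \<in> P \<and> g t \<in> Q) \<or> (g s \<in> Q \<and> g t \<in> P))"

text \<open>
  The bridges are the projections of \<^term>\<open>b i\<close>, the under-strands those of \<^term>\<open>u j\<close>.  The truth
  values serve as indices, so that \<^term>\<open>b (\<not> i)\<close> is the bridge other than \<^term>\<open>b i\<close>.
\<close>

definition schubert_normal_form :: "space set \<Rightarrow> bool" where
  "schubert_normal_form D \<longleftrightarrow> link_diagram D \<and>
     (\<exists>b u :: bool \<Rightarrow> real \<Rightarrow> space.
        D = (\<Union>i. path_image (b i)) \<union> (\<Union>j. path_image (u j)) \<and>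
        (\<forall>i. path (b i) \<and> arc (fst \<circ> b i)) \<and>
        (\<forall>j. path (u j) \<and> arc (fst \<circ> u j)) \<and>
        disjnt (path_image (fst \<circ> b True)) (path_image (fst \<circ> b False)) \<and>
        disjnt (path_image (fst \<circ> u True)) (path_image (fst \<circ> u False)) \<and>
        (\<Union>j. {pathstart (u j), pathfinish (u j)}) = (\<Union>i. {pathstart (b i), pathfinish (b i)}) \<and>
        (\<forall>i j. path_image (b i) \<inter> path_image (u j) \<subseteq> {pathstart (b i), pathfinish (b i)}) \<and>
        (\<forall>z\<in>crossings D. \<exists>i j. \<exists>s\<in>{0<..<1}. \<exists>t\<in>{0<..<1}.
           fst (b i s) = z \<and> fst (u j t) = z \<and> snd (u j t) < snd (b i s)) \<and>
        (\<forall>i j. \<forall>g\<in>{u j, reversepath (u j)}. pathstart g \<in> {pathstart (b i), pathfinish (b i)} \<longrightarrow>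
           first_meets (fst \<circ> g) (path_image (fst \<circ> b (\<not> i))) (path_image (fst \<circ> b i))) \<and>
        (\<forall>j. meets_alternately (fst \<circ> u j)
               (path_image (fst \<circ> b True)) (path_image (fst \<circ> b False))) \<and>
        (\<forall>i. meets_alternately (fst \<circ> b i)
               (path_image (fst \<circ> u True)) (path_image (fst \<circ> u False))))"

end

theory Submission
  imports Defs
begin

text \<open>
  The idea is to follow one under-strand of the normal form from end to end.  Both of its ends lie
  on bridges, and no bridge passes under anything, so each bridge lies in a single arc of the
  diagram.  Let \<open>a\<close> be the color of the bridge where the under-strand starts and \<open>a + d\<close> that of the
  other one.  The coloring rule says that passing under a bridge reflects the color in the color of
  that bridge.  The under-strand passes first under the other bridge and then under the two
  alternately, so its successive arcs have the colors
  \<open>a, a + 2 d, a - 2 d, a + 4 d, a - 4 d, \<dots>\<close> modulo \<open>p\<close>, that is \<open>a + d * zigzag k\<close> after \<open>k\<close>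
  crossings (lemma \<open>strand_colors\<close>).

  If \<open>p\<close> divided \<open>d\<close>, then these colors would all be \<open>a\<close>; since the bridges and the two
  under-strands fill the diagram, the coloring would be trivial (\<open>equal_bridge_colors_trivial\<close>).
  So \<open>d\<close> is invertible modulo \<open>p\<close>.  The last arc of the under-strand is that of a bridge, which
  has the color \<open>a\<close> or \<open>a + d\<close>.  After \<open>n\<close> crossings, with \<open>n \<ge> 1\<close>, this makes \<open>zigzag n\<close>
  congruent to 0 or 1, and the shape of the zigzag then forces \<open>n \<ge> p - 1\<close>
  (\<open>zigzag_return_bound\<close>).  But the first \<open>p\<close> values of the zigzag already represent every residue,
  because \<open>p\<close> is odd (\<open>zigzag_hits_every_residue\<close>), so every color occurs along this single strand.

  The rest of the argument is topological: reading off the sequence of arcs of an under-strand,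
  with the crossings between them, from the conditions on the curves of the normal form
  (\<open>strand_arcs\<close>).
\<close>

section \<open>Reflecting alternately in two colors\<close>

text \<open>
  The sequence \<open>0, 2, -2, 4, -4, \<dots>\<close>, in which the sum of two successive terms is alternately 2
  and 0: the orbit of 0 under alternate reflections in 1 and in 0.
\<close>

definition zigzag :: "nat \<Rightarrow> int" where
  "zigzag k = (if even k then - int k else int k + 1)"

lemma alternating_reflections_zigzag:
  fixes x :: "nat \<Rightarrow> int"
  assumes "[x 0 = a] (mod q)"
    and step: "\<And>k. k < n \<Longrightarrow> [2 * (if even k then a + d else a) = x k + x (Suc k)] (mod q)"
    and "k \<le> n"
  shows "[x k = a + d * zigzag k] (mod q)"
  using \<open>k \<le> n\<close>
proof (induction k)
  case 0
  then show ?case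
    using assms(1) by (simp add: zigzag_def)
next
  case (Suc k)
  have "[x (Suc k) = 2 * (if even k then a + d else a) - x k] (mod q)"
    using step[of k] Suc.prems by (simp add: cong_iff_dvd_diff dvd_diff_commute algebra_simps)
  also have "[2 * (if even k then a + d else a) - x k
      = 2 * (if even k then a + d else a) - (a + d * zigzag k)] (mod q)"
    using Suc by (intro cong_diff) auto
  also have "2 * (if even k then a + d else a) - (a + d * zigzag k) = a + d * zigzag (Suc k)"
    by (simp add: zigzag_def algebra_simps)
  finally show ?case .
qed

text \<open>
  For even \<open>n\<close> the numbers \<open>zigzag n\<close> and \<open>zigzag n - 1\<close> are \<open>-n\<close> and \<open>-(n + 1)\<close>, for odd \<open>n\<close> they are
  \<open>n + 1\<close> and \<open>n\<close>.  So a divisor of one of them divides \<open>n\<close> or \<open>n + 1\<close>.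
\<close>

lemma zigzag_return_bound:
  assumes "n \<ge> 1" and "int p dvd zigzag n \<or> int p dvd zigzag n - 1"
  shows "p \<le> Suc n"
proof -
  have "int p dvd int n \<or> int p dvd int (Suc n)"
    using assms(2) by (auto simp: zigzag_def add.commute dvd_minus_iff[symmetric, of "int p" "- int n - 1"]
        split: if_splits)
  then show ?thesis
    using assms(1) unfolding int_dvd_int_iff by (auto dest!: dvd_imp_le)
qed

text \<open>
  Up to index \<open>p - 1\<close> the zigzag takes exactly the even values between \<open>-(p - 1)\<close> and \<open>p - 1\<close>.  An
  even residue is one of the nonnegative values; an odd one becomes one of the negative values
  when the odd number \<open>p\<close> is subtracted.
\<close>

lemma zigzag_hits_every_residue:
  assumes "odd p"
  obtains k where "k < p" and "[zigzag k = v] (mod int p)"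
proof -
  define r where "r = nat (v mod int p)"
  have "p > 0" using assms by (auto intro: Nat.gr0I)
  then have r: "int r = v mod int p" "r < p"
    by (auto simp: r_def nat_less_iff)
  have v: "[int r = v] (mod int p)"
    by (simp add: r cong_def)
  show ?thesis
  proof (cases "r = 0")
    case True
    then show ?thesis
      using that[of 0] \<open>p > 0\<close> v by (simp add: zigzag_def)
  next
    case False
    show ?thesis
    proof (cases "even r")
      case True
      then have "zigzag (r - 1) = int r"
        using False by (auto simp: zigzag_def)
      then show ?thesis
        using that[of "r - 1"] r v by simp
    next
      case odd: False
      have "zigzag (p - r) = int r - int p"
        using odd assms r by (auto simp: zigzag_def)
      moreover have "[int r - int p = int r] (mod int p)"
        by (simp add: cong_iff_dvd_diff)
      ultimately show ?thesis
        using that[of "p - r"] False r v by (auto intro: cong_trans)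
    qed
  qed
qed

lemma progression_through_zigzag:
  assumes "prime p" and "odd p" and "\<not> int p dvd d"
  obtains m where "m < p" and "[a + d * zigzag m = k] (mod int p)"
proof -
  have "coprime d (int p)"
    using assms by (metis coprime_commute prime_imp_coprime prime_nat_int_transfer)
  then obtain w where w: "[d * w = 1] (mod int p)"
    using cong_solve_coprime_int by blast
  obtain m where m: "m < p" "[zigzag m = w * (k - a)] (mod int p)"
    using zigzag_hits_every_residue[OF assms(2)] .
  have "[a + d * zigzag m = a + d * (w * (k - a))] (mod int p)"
    using m(2) by (intro cong_add cong_mult) auto
  also have "a + d * (w * (k - a)) = a + (d * w) * (k - a)"
    by simp
  also have "[\<dots> = a + 1 * (k - a)] (mod int p)"
    using w by (intro cong_add cong_mult) auto
  finally show ?thesis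
    using that m(1) by simp
qed

section \<open>Arcs of a diagram\<close>

text \<open>
  For a point outside the under-crossings this is the arc of the diagram that contains it.
\<close>

definition arc_through :: "space set \<Rightarrow> space \<Rightarrow> space set" where
  "arc_through D x = connected_component_set (D - under_points D) x"

lemma diagram_arcs_eq: "diagram_arcs D = arc_through D ` (D - under_points D)"
  by (simp add: diagram_arcs_def components_def arc_through_def)

lemma arc_through_self: "x \<in> D - under_points D \<Longrightarrow> x \<in> arc_through D x"
  by (simp add: arc_through_def)

lemma arc_through_eq:
  assumes "connected S" and "S \<subseteq> D - under_points D" and "x \<in> S" and "y \<in> S"
  shows "arc_through D x = arc_through D y"
  unfolding arc_through_def
  using assms by (intro connected_component_eq) (auto simp: connected_component_def)

text \<open>
  The end points of the interval are added as terms number 0 and \<open>card T + 1\<close>, so that the gaps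
  between successive terms are the pieces into which \<open>T\<close> cuts the whole interval.
\<close>

lemma enumerate_interior_points:
  fixes T :: "real set"
  assumes "finite T" and "T \<subseteq> {0<..<1}"
  obtains \<tau> where "\<tau> 0 = 0" and "\<tau> (Suc (card T)) = 1"
    and "strict_mono_on {..Suc (card T)} \<tau>"
    and "T = \<tau> ` {1..card T}"
proof -
  define xs where "xs = sorted_list_of_set T"
  have xs: "set xs = T" "length xs = card T" "sorted_wrt (<) xs"
    using assms by (auto simp: xs_def)
  let ?\<tau> = "nth (0 # xs @ [1])"
  have "sorted_wrt (<) (0 # xs @ [1])"
    using xs assms(2) by (auto simp: sorted_wrt_append)
  then have "strict_mono_on {..Suc (card T)} ?\<tau>"
    using xs(2) sorted_wrt_nth_less[of "(<)" "0 # xs @ [1]"] by (intro strict_mono_onI) simp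
  moreover have "T = ?\<tau> ` {1..card T}"
  proof -
    have "?\<tau> ` {1..card T} = ?\<tau> ` Suc ` {..<card T}"
      by (simp add: image_Suc_lessThan)
    also have "\<dots> = (\<lambda>k. xs ! k) ` {..<length xs}"
      unfolding image_image xs(2)[symmetric] by (intro image_cong) (auto simp: nth_append)
    also have "\<dots> = T"
      using xs(1) by (auto simp: set_conv_nth)
    finally show ?thesis ..
  qed
  ultimately show ?thesis
    using that[of ?\<tau>] xs(2) by (simp add: nth_append)
qed

section \<open>The under-strands of a Schubert normal form\<close>

lemma crossingI: "k < h \<Longrightarrow> (z, h) \<in> D \<Longrightarrow> (z, k) \<in> D \<Longrightarrow> z \<in> crossings D"
  unfolding crossings_def by blast

text \<open>
  Applied to the two bridges and to the two under-strands: a point of the plane determines at most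
  one point on the bridges and at most one on the under-strands.
\<close>

lemma planar_inj:
  fixes f :: "bool \<Rightarrow> real \<Rightarrow> space"
  assumes "\<And>i. arc (fst \<circ> f i)" and "disjnt (path_image (fst \<circ> f True)) (path_image (fst \<circ> f False))"
    and "s \<in> {0..1}" "t \<in> {0..1}" "fst (f i s) = fst (f j t)"
  shows "i = j \<and> s = t"
proof -
  have "i = j"
  proof (rule ccontr)
    assume "i \<noteq> j"
    moreover have "(fst \<circ> f i) s \<in> path_image (fst \<circ> f i)" "(fst \<circ> f j) t \<in> path_image (fst \<circ> f j)"
      using assms(3,4) by (auto simp: path_image_def)
    ultimately show False
      using assms(2,5) by (cases i; cases j) (auto simp: disjnt_iff)
  qed
  moreover have "inj_on (fst \<circ> f i) {0..1}"
    using assms(1) by (simp add: arc_def)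
  ultimately show ?thesis
    using assms(3-5) by (auto simp: inj_on_def)
qed

text \<open>
  The two families of curves of a normal form together with the conditions that govern the
  under-strands.  Here \<open>first_bridge\<close> and \<open>alternate_bridges\<close> concern the bridges met by an
  under-strand in its direction of travel.
\<close>

locale schubert_picture =
  fixes D :: "space set" and b u :: "bool \<Rightarrow> real \<Rightarrow> space"
  assumes finite_crossings: "finite (crossings D)"
    and D_eq: "D = (\<Union>i. path_image (b i)) \<union> (\<Union>j. path_image (u j))"
    and path_bridge: "path (b i)" and arc_bridge: "arc (fst \<circ> b i)"
    and path_strand: "path (u j)" and arc_strand: "arc (fst \<circ> u j)"
    and disjnt_bridges: "disjnt (path_image (fst \<circ> b True)) (path_image (fst \<circ> b False))"
    and disjnt_strands: "disjnt (path_image (fst \<circ> u True)) (path_image (fst \<circ> u False))"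
    and ends_eq: "(\<Union>j. {pathstart (u j), pathfinish (u j)}) = (\<Union>i. {pathstart (b i), pathfinish (b i)})"
    and common_points: "path_image (b i) \<inter> path_image (u j) \<subseteq> {pathstart (b i), pathfinish (b i)}"
    and crossing_form: "z \<in> crossings D \<Longrightarrow> \<exists>i j. \<exists>s\<in>{0<..<1}. \<exists>t\<in>{0<..<1}.
      fst (b i s) = z \<and> fst (u j t) = z \<and> snd (u j t) < snd (b i s)"
    and first_bridge: "pathstart (u j) \<in> {pathstart (b i), pathfinish (b i)} \<Longrightarrow>
      first_meets (fst \<circ> u j) (path_image (fst \<circ> b (\<not> i))) (path_image (fst \<circ> b i))"
    and alternate_bridges: "meets_alternately (fst \<circ> u j)
      (path_image (fst \<circ> b True)) (path_image (fst \<circ> b False))"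
begin

lemmas bridge_inj = planar_inj[of b, OF arc_bridge disjnt_bridges]
  and strand_inj = planar_inj[of u, OF arc_strand disjnt_strands]

lemma in_D: "s \<in> {0..1} \<Longrightarrow> b i s \<in> D" "s \<in> {0..1} \<Longrightarrow> u j s \<in> D"
  unfolding D_eq path_image_def by blast+

text \<open>
  If the two points were equal, they would be a common end of a bridge and some under-strand, while
  \<open>t\<close> is an interior parameter.  Hence they have different heights and form a crossing, which by
  injectivity of the projections is the one described by \<open>crossing_form\<close>.
\<close>

lemma strand_meets_bridge:
  assumes t: "0 < t" "t < 1" and s: "s \<in> {0..1}" and z: "fst (u j t) = fst (b i s)"
  shows "snd (u j t) < snd (b i s)"
proof -
  have t': "t \<in> {0..1}" using t by simp
  have "b i s \<noteq> u j t"
  proof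
    assume eq: "b i s = u j t"
    then have "u j t \<in> path_image (b i) \<inter> path_image (u j)"
      using s t' by (metis IntI image_eqI path_image_def)
    then have "u j t \<in> {pathstart (b i), pathfinish (b i)}"
      by (rule subsetD[OF common_points])
    then have "u j t \<in> (\<Union>j. {pathstart (u j), pathfinish (u j)})"
      unfolding ends_eq by blast
    then obtain l e where "e \<in> {0, 1}" "u j t = u l e"
      by (auto simp: pathstart_def pathfinish_def)
    then show False
      using strand_inj[of t e j l] t by auto
  qed
  then have "snd (b i s) \<noteq> snd (u j t)"
    using z by (auto simp: prod_eq_iff)
  moreover have "(fst (b i s), snd (b i s)) \<in> D" "(fst (b i s), snd (u j t)) \<in> D"
    using in_D(1)[OF s, of i] in_D(2)[OF t', of j] by (simp, simp flip: z)
  ultimately have "fst (b i s) \<in> crossings D"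
    by (meson crossingI neq_iff)
  then obtain k l r w where *: "r \<in> {0<..<1}" "w \<in> {0<..<1}" "fst (b k r) = fst (b i s)"
      "fst (u l w) = fst (b i s)" "snd (u l w) < snd (b k r)"
    using crossing_form by blast
  have "k = i \<and> r = s"
    using *(1,3) s by (intro bridge_inj) auto
  moreover have "l = j \<and> w = t"
    using *(2,4) t z by (intro strand_inj) auto
  ultimately show ?thesis
    using *(5) by simp
qed

lemma under_pointI:
  assumes "0 < t" "t < 1" "s \<in> {0..1}" "fst (u j t) = fst (b i s)"
  shows "u j t \<in> under_points D" and "fst (u j t) \<in> crossings D"
proof -
  have "(fst (u j t), snd (u j t)) \<in> D" "(fst (u j t), snd (b i s)) \<in> D"
    using in_D(2)[of t j] in_D(1)[of s i] assms(1-3) by (simp, simp add: assms(4))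
  then show "fst (u j t) \<in> crossings D" "u j t \<in> under_points D"
    using strand_meets_bridge[OF assms] crossingI by (blast, auto simp: under_points_def case_prod_unfold)
qed

lemma point_cases:
  assumes "x \<in> D"
  shows "(\<exists>i. \<exists>s\<in>{0..1}. x = b i s) \<or> (\<exists>j. \<exists>t\<in>{0..1}. x = u j t)"
  using assms unfolding D_eq path_image_def by blast

text \<open>
  Only two points of the diagram lie over a crossing, and the lower one is on an under-strand.
\<close>

lemma under_pointE:
  assumes "x \<in> under_points D"
  obtains j t i s where "0 < t" "t < 1" "s \<in> {0..1}" "x = u j t" "fst (u j t) = fst (b i s)"
proof -
  obtain h where h: "x \<in> D" "snd x < h" "(fst x, h) \<in> D"
    using assms by (auto simp: under_points_def)
  then have "fst x \<in> crossings D"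
    unfolding crossings_def by (metis (mono_tags, lifting) mem_Collect_eq prod.collapse)
  then obtain i j s t where *: "s \<in> {0<..<1}" "t \<in> {0<..<1}" "fst (b i s) = fst x"
      "fst (u j t) = fst x" "snd (u j t) < snd (b i s)"
    using crossing_form by blast
  have two: "y = b i s \<or> y = u j t" if "y \<in> D" "fst y = fst x" for y
    using point_cases[OF that(1)]
  proof (elim disjE exE bexE)
    fix k r assume "r \<in> {0..1}" "y = b k r"
    then show ?thesis
      using bridge_inj[of r s k i] *(1,3) that(2) by auto
  next
    fix k r assume "r \<in> {0..1}" "y = u k r"
    then show ?thesis
      using strand_inj[of r t k j] *(2,4) that(2) by auto
  qed
  have x: "x = u j t"
    using two[OF h(1)] two[OF h(3)] h(2) *(5) by (auto simp: prod_eq_iff)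
  have z: "fst (u j t) = fst (b i s)"
    using *(3,4) by simp
  show ?thesis
    by (rule that[OF _ _ _ x z]) (use *(1,2) in simp_all)
qed

lemma bridge_not_under:
  assumes "s \<in> {0..1}"
  shows "b i s \<notin> under_points D"
proof
  assume "b i s \<in> under_points D"
  then obtain j t k r where "0 < t" "t < 1" "b i s = u j t"
    by (metis under_pointE)
  then show False
    using strand_meets_bridge[of t s j i] assms by simp
qed

lemma strand_under_iff:
  assumes "t \<in> {0..1}"
  shows "u j t \<in> under_points D \<longleftrightarrow>
    t \<in> {0<..<1} \<and> fst (u j t) \<in> path_image (fst \<circ> b True) \<union> path_image (fst \<circ> b False)"
    (is "?L \<longleftrightarrow> ?R")
proof
  assume ?L
  then obtain l w i s where *: "0 < w" "w < 1" "s \<in> {0..1}" "u j t = u l w" "fst (u l w) = fst (b i s)"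
    by (metis under_pointE)
  have "l = j \<and> w = t"
    using * assms by (intro strand_inj) auto
  then show ?R
    using * by (cases i) (auto simp: path_image_def)
next
  assume ?R
  then show ?L
    by (auto simp: path_image_def intro: under_pointI)
qed

definition bridge_arc :: "bool \<Rightarrow> space set" where
  "bridge_arc i = arc_through D (pathstart (b i))"

lemma arc_through_bridge:
  assumes "s \<in> {0..1}"
  shows "arc_through D (b i s) = bridge_arc i"
  unfolding bridge_arc_def
proof (rule arc_through_eq)
  show "connected (path_image (b i))"
    using path_bridge by (rule connected_path_image)
  show "path_image (b i) \<subseteq> D - under_points D"
    using bridge_not_under in_D by (auto simp: path_image_def)
qed (use assms in \<open>auto simp: path_image_def pathstart_def\<close>)

lemma bridge_arc_in: "bridge_arc i \<in> diagram_arcs D"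
  using in_D(1)[of 0 i] bridge_not_under[of 0 i]
  by (auto simp: bridge_arc_def diagram_arcs_eq pathstart_def)

lemma arc_through_strand_eq:
  assumes "closed_segment r s \<subseteq> {0..1}" and "\<And>t. t \<in> closed_segment r s \<Longrightarrow> u j t \<notin> under_points D"
  shows "arc_through D (u j r) = arc_through D (u j s)"
proof (rule arc_through_eq)
  have "continuous_on (closed_segment r s) (u j)"
    using path_strand assms(1) by (auto simp: path_def intro: continuous_on_subset)
  then show "connected (u j ` closed_segment r s)"
    by (intro connected_continuous_image) auto
  show "u j ` closed_segment r s \<subseteq> D - under_points D"
    using assms in_D by auto
qed auto

lemma arc_through_strand_end:
  assumes "e \<in> {0, 1}"
  obtains i where "u j e \<in> {pathstart (b i), pathfinish (b i)}"
    and "arc_through D (u j e) = bridge_arc i"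
proof -
  have "u j e \<in> (\<Union>j. {pathstart (u j), pathfinish (u j)})"
    using assms by (auto simp: pathstart_def pathfinish_def)
  then obtain i where "u j e \<in> {pathstart (b i), pathfinish (b i)}"
    unfolding ends_eq by blast
  moreover from this have "u j e = b i 0 \<or> u j e = b i 1"
    unfolding pathstart_def pathfinish_def by blast
  then have "arc_through D (u j e) = bridge_arc i"
    using arc_through_bridge[of 0 i] arc_through_bridge[of 1 i] by (elim disjE) simp_all
  ultimately show ?thesis
    using that by blast
qed

text \<open>
  The piece of the under-strand between \<open>r\<close> and \<open>t\<close> is the path across the crossing that the
  relation between over-arc and under-arcs asks for.
\<close>

lemma arcs_at_strand:
  assumes rst: "0 \<le> r" "r < s" "s < t" "t \<le> 1"
    and w: "w \<in> {0..1}" "fst (u j s) = fst (b i w)"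
    and only: "\<And>v. v \<in> {r..t} \<Longrightarrow> v \<noteq> s \<Longrightarrow> u j v \<notin> under_points D"
  shows "arcs_at D (fst (u j s)) (bridge_arc i) (arc_through D (u j r)) (arc_through D (u j t))"
proof -
  have ends: "u j r \<in> D - under_points D" "u j t \<in> D - under_points D"
    using rst only in_D by auto
  have inj: "inj_on (u j) {0..1}"
    using strand_inj by (metis inj_onI)
  have im: "path_image (subpath r t (u j)) = u j ` {r..t}"
    using rst by (simp add: path_image_subpath)
  have "arc (u j)"
    using inj path_strand by (simp add: arc_def)
  then have "arc (subpath r t (u j))"
    using rst by (intro arc_subpath_arc) auto
  moreover have "path_image (subpath r t (u j)) \<subseteq> D"
    using im rst in_D by auto
  moreover have "path_image (subpath r t (u j)) \<inter> under_points D = {u j s}"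
  proof -
    have "u j s \<in> under_points D"
      using under_pointI(1)[of s w j i] rst w by auto
    then show ?thesis
      unfolding im using only rst by fastforce
  qed
  moreover have "(fst (u j s), snd (b i w)) \<in> bridge_arc i"
    using arc_through_self[of "b i w" D] arc_through_bridge[OF w(1), of i] in_D(1)[OF w(1)]
      bridge_not_under[OF w(1)] w(2) by auto
  moreover have "snd (u j s) < snd (b i w)"
    using strand_meets_bridge[of s w j i] rst w by auto
  moreover have "(fst (u j s), snd (u j s)) \<in> D"
    using in_D rst by auto
  moreover have "pathstart (subpath r t (u j)) \<in> arc_through D (u j r)"
      "pathfinish (subpath r t (u j)) \<in> arc_through D (u j t)"
    using ends arc_through_self by auto
  moreover have "arc_through D (u j r) \<in> diagram_arcs D" "arc_through D (u j t) \<in> diagram_arcs D"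
    using ends by (auto simp: diagram_arcs_eq)
  ultimately show ?thesis
    unfolding arcs_at_def prod.collapse
    using bridge_arc_in by (metis prod.collapse)
qed

text \<open>
  The under-crossings of a strand are exactly its interior parameters that project into a bridge, and
  there are finitely many of them.  They cut the strand into pieces, each within one arc of the
  diagram.  The arcs occurring in this order are the sequence \<open>A\<close>; which bridge separates \<open>A k\<close> from
  \<open>A (Suc k)\<close> is determined by the parity of \<open>k\<close>, because the strand first meets the bridge other than
  the one where it starts and alternates thereafter.
\<close>

lemma strand_arcs:
  obtains i i' n A where "n \<ge> 1" and "A 0 = bridge_arc i" and "A n = bridge_arc i'"
    and "\<And>k. k \<le> n \<Longrightarrow> A k \<in> diagram_arcs D"
    and "\<And>k. k < n \<Longrightarrow> \<exists>z\<in>crossings D.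
      arcs_at D z (bridge_arc (if even k then \<not> i else i)) (A k) (A (Suc k))"
    and "\<And>t. t \<in> {0..1} \<Longrightarrow> u j t \<notin> under_points D \<Longrightarrow> \<exists>k\<le>n. arc_through D (u j t) = A k"
proof -
  define T where "T = {t \<in> {0..1}. u j t \<in> under_points D}"
  define n where "n = card T"
  define B where "B i = path_image (fst \<circ> b i)" for i
  have B_both: "B i \<union> B (\<not> i) = B True \<union> B False" for i
    by (cases i) auto
  have T_iff: "t \<in> T \<longleftrightarrow> t \<in> {0<..<1} \<and> fst (u j t) \<in> B True \<union> B False" for t
    using strand_under_iff[of t j] by (auto simp: T_def B_def)
  have "finite T"
  proof (rule finite_imageD)
    have "(fst \<circ> u j) ` T \<subseteq> crossings D"
      by (auto simp: T_iff B_def path_image_def intro: under_pointI)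
    then show "finite ((fst \<circ> u j) ` T)"
      using finite_crossings finite_subset by blast
    show "inj_on (fst \<circ> u j) T"
      using strand_inj by (auto simp: T_def inj_on_def)
  qed
  moreover have "T \<subseteq> {0<..<1}"
    by (rule subsetI) (simp add: T_iff)
  ultimately obtain \<tau> where \<tau>0: "\<tau> 0 = 0" and \<tau>1: "\<tau> (Suc n) = 1"
    and mono: "strict_mono_on {..Suc n} \<tau>" and T_eq: "T = \<tau> ` {1..n}"
    by (rule enumerate_interior_points[of T, folded n_def])
  have less: "\<tau> k < \<tau> l" if "k < l" "l \<le> Suc n" for k l
    using strict_mono_onD[OF mono, of k l] that by simp
  have le: "\<tau> k \<le> \<tau> l" if "k \<le> l" "l \<le> Suc n" for k l
    using less[of k l] that by (cases "k = l") auto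
  have gap: "t \<notin> T" if "k \<le> n" "\<tau> k < t" "t < \<tau> (Suc k)" for k t
  proof
    assume "t \<in> T"
    then obtain l where l: "1 \<le> l" "l \<le> n" "t = \<tau> l"
      using T_eq by auto
    show False
      using le[of l k] le[of "Suc k" l] l that by (cases "l \<le> k") auto
  qed
  \<comment> \<open>The midpoint of a gap serves as the sample point for the arc that contains this piece.\<close>
  define m where "m k = (\<tau> k + \<tau> (Suc k)) / 2" for k
  have m: "\<tau> k < m k" "m k < \<tau> (Suc k)" if "k \<le> n" for k
    using less[of k "Suc k"] that by (auto simp: m_def)
  have \<tau>01: "\<tau> k \<in> {0..1}" if "k \<le> Suc n" for k
    using le[of 0 k] le[of k "Suc n"] that \<tau>0 \<tau>1 by auto
  define A where "A k = arc_through D (u j (m k))" for k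
  have m01: "m k \<in> {0..1}" if "k \<le> n" for k
    using m[OF that] \<tau>01[of k] \<tau>01[of "Suc k"] that by auto
  have A_in: "A k \<in> diagram_arcs D" if "k \<le> n" for k
    using gap[OF that m[OF that]] m01[OF that] in_D(2)[of "m k" j]
    by (auto simp: A_def diagram_arcs_eq T_def)
  have A_eq: "arc_through D (u j t) = A k"
    if k: "k \<le> n" and t: "t \<in> {\<tau> k..\<tau> (Suc k)}" "t \<notin> T" for k t
    unfolding A_def
  proof (rule arc_through_strand_eq)
    have sub: "closed_segment t (m k) \<subseteq> insert t {\<tau> k<..<\<tau> (Suc k)}"
      using t(1) m[OF k] by (auto simp: closed_segment_eq_real_ivl split: if_splits)
    show seg: "closed_segment t (m k) \<subseteq> {0..1}"
      using sub t(1) \<tau>01[of k] \<tau>01[of "Suc k"] k by fastforce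
    show "u j v \<notin> under_points D" if "v \<in> closed_segment t (m k)" for v
    proof -
      have "v = t \<or> v \<in> {\<tau> k<..<\<tau> (Suc k)}"
        using sub that by blast
      then have "v \<notin> T"
        using t(2) gap[OF k, of v] by auto
      then show ?thesis
        using seg that by (auto simp: T_def)
    qed
  qed
  have zero_one: "0 \<notin> T" "1 \<notin> T"
    by (simp_all add: T_iff)
  obtain i where i: "u j 0 \<in> {pathstart (b i), pathfinish (b i)}" "arc_through D (u j 0) = bridge_arc i"
    by (rule arc_through_strand_end[of 0 j]) auto
  obtain i' where i': "arc_through D (u j 1) = bridge_arc i'"
    by (rule arc_through_strand_end[of 1 j]) auto
  \<comment> \<open>The first meeting with the other bridge, which exists by \<open>first_bridge\<close>, has to be \<open>\<tau> 1\<close>.\<close>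
  have first: "n \<ge> 1 \<and> fst (u j (\<tau> 1)) \<in> B (\<not> i)"
  proof -
    have "first_meets (fst \<circ> u j) (B (\<not> i)) (B i)"
      unfolding B_def using i(1) by (intro first_bridge) (simp add: pathstart_def)
    then obtain t where t: "t \<in> {0<..<1}" "fst (u j t) \<in> B (\<not> i)"
      and before: "\<And>s. s \<in> {0<..<t} \<Longrightarrow> fst (u j s) \<notin> B (\<not> i) \<union> B i"
      unfolding first_meets_def by auto
    have "t \<in> T"
      using t B_both[of i] by (auto simp: T_iff)
    then obtain l where l: "1 \<le> l" "l \<le> n" "t = \<tau> l"
      using T_eq by auto
    have "l = 1"
    proof (rule ccontr)
      assume "l \<noteq> 1"
      then have "\<tau> 1 < t" using l less[of 1 l] by auto
      moreover have "\<tau> 1 \<in> T" using T_eq l by auto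
      ultimately show False
        using before[of "\<tau> 1"] B_both[of i] by (auto simp: T_iff)
    qed
    then show ?thesis using l t by auto
  qed
  have disj: "B i \<inter> B (\<not> i) = {}" for i
    using disjnt_bridges by (cases i) (auto simp: disjnt_def B_def)
  have bridge_at: "fst (u j (\<tau> (Suc k))) \<in> B (if even k then \<not> i else i)" if "k < n" for k
    using that
  proof (induction k)
    case 0
    then show ?case using first by simp
  next
    case (Suc k)
    let ?s = "\<tau> (Suc k)" and ?t = "\<tau> (Suc (Suc k))"
    have "?s \<in> T" "?t \<in> T" "?s < ?t"
      using T_eq Suc.prems less[of "Suc k" "Suc (Suc k)"] by auto
    moreover have "\<forall>r\<in>{?s<..<?t}. fst (u j r) \<notin> B True \<union> B False"
    proof
      fix r assume r: "r \<in> {?s<..<?t}"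
      have "r \<notin> T"
        using gap[of "Suc k" r] Suc.prems r by auto
      moreover have "r \<in> {0<..<1}"
        using r \<open>?s \<in> T\<close> \<open>?t \<in> T\<close> by (auto simp: T_iff)
      ultimately show "fst (u j r) \<notin> B True \<union> B False"
        using T_iff by blast
    qed
    ultimately have "fst (u j ?s) \<in> B True \<and> fst (u j ?t) \<in> B False \<or>
        fst (u j ?s) \<in> B False \<and> fst (u j ?t) \<in> B True"
      using alternate_bridges[of j] unfolding meets_alternately_def T_iff B_def[symmetric] by simp
    then show ?case
      using Suc disj[of True] by (cases i) (auto split: if_splits)
  qed
  have crossing: "\<exists>z\<in>crossings D.
      arcs_at D z (bridge_arc (if even k then \<not> i else i)) (A k) (A (Suc k))" if k: "k < n" for k
  proof -
    let ?i = "if even k then \<not> i else i"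
    have s: "\<tau> (Suc k) \<in> T"
      using T_eq k by auto
    obtain w where w: "w \<in> {0..1}" "fst (u j (\<tau> (Suc k))) = fst (b ?i w)"
      using bridge_at[OF k] unfolding B_def path_image_def by auto
    have "fst (u j (\<tau> (Suc k))) \<in> crossings D"
      using under_pointI(2)[OF _ _ w] s by (auto simp: T_iff)
    moreover have "arcs_at D (fst (u j (\<tau> (Suc k)))) (bridge_arc ?i) (A k) (A (Suc k))"
      unfolding A_def
    proof (rule arcs_at_strand[OF _ _ _ _ w])
      show "0 \<le> m k" "m (Suc k) \<le> 1"
        using m01[of k] m01[of "Suc k"] k by auto
      show "m k < \<tau> (Suc k)" "\<tau> (Suc k) < m (Suc k)"
        using m[of k] m[of "Suc k"] k by auto
      show "u j v \<notin> under_points D" if v: "v \<in> {m k..m (Suc k)}" "v \<noteq> \<tau> (Suc k)" for v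
      proof -
        have "v \<notin> T"
          using gap[of k v] gap[of "Suc k" v] m[of k] m[of "Suc k"] v k
          by (cases "v < \<tau> (Suc k)") auto
        then show ?thesis
          using v m01[of k] m01[of "Suc k"] k by (auto simp: T_def)
      qed
    qed
    ultimately show ?thesis by blast
  qed
  have cover: "\<exists>k\<le>n. arc_through D (u j t) = A k" if t: "t \<in> {0..1}" "u j t \<notin> under_points D" for t
  proof -
    \<comment> \<open>The index of the gap that contains \<open>t\<close>, where \<open>t = 1\<close> belongs to the last gap \<open>n\<close>.\<close>
    define k where "k = Max {k. k \<le> n \<and> \<tau> k \<le> t}"
    have fin: "finite {k. k \<le> n \<and> \<tau> k \<le> t}" by simp
    moreover have "0 \<in> {k. k \<le> n \<and> \<tau> k \<le> t}" using t \<tau>0 by simp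
    ultimately have "k \<in> {k. k \<le> n \<and> \<tau> k \<le> t}"
      unfolding k_def by (intro Max_in) auto
    then have k: "k \<le> n" "\<tau> k \<le> t" by auto
    have "t \<le> \<tau> (Suc k)"
    proof (cases "k = n")
      case True
      then show ?thesis using t \<tau>1 by simp
    next
      case False
      then have "\<not> \<tau> (Suc k) \<le> t"
        using Max_ge[OF fin, of "Suc k"] k(1) by (auto simp: k_def[symmetric])
      then show ?thesis by simp
    qed
    then show ?thesis
      using A_eq[of k t] k t by (auto simp: T_def)
  qed
  show ?thesis
  proof (rule that)
    show "A 0 = bridge_arc i"
      using A_eq[of 0 0] zero_one i(2) \<tau>0 \<tau>01[of 1] by simp
    show "A n = bridge_arc i'"
      using A_eq[of n 1] zero_one i' \<tau>1 \<tau>01[of n] by simp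
  qed (use first A_in crossing cover in auto)
qed

section \<open>Colors along an under-strand\<close>

text \<open>
  At a crossing the coloring rule makes the second under-arc the reflection of the first one in the
  color of the bridge above, so the colors along the strand follow the zigzag.
\<close>

lemma strand_colors:
  assumes "coloring p D c"
  obtains i i' n A where "n \<ge> 1" and "A n = bridge_arc i'"
    and "\<And>k. k \<le> n \<Longrightarrow> A k \<in> diagram_arcs D"
    and "\<And>k. k \<le> n \<Longrightarrow> [c (A k) = c (bridge_arc i)
      + (c (bridge_arc (\<not> i)) - c (bridge_arc i)) * zigzag k] (mod int p)"
    and "\<And>t. t \<in> {0..1} \<Longrightarrow> u j t \<notin> under_points D \<Longrightarrow> \<exists>k\<le>n. arc_through D (u j t) = A k"
proof -
  obtain i i' n A where n: "n \<ge> 1" and A0: "A 0 = bridge_arc i" and An: "A n = bridge_arc i'"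
    and A: "\<And>k. k \<le> n \<Longrightarrow> A k \<in> diagram_arcs D"
    and step: "\<And>k. k < n \<Longrightarrow> \<exists>z\<in>crossings D.
      arcs_at D z (bridge_arc (if even k then \<not> i else i)) (A k) (A (Suc k))"
    and cover: "\<And>t. t \<in> {0..1} \<Longrightarrow> u j t \<notin> under_points D \<Longrightarrow>
      \<exists>k\<le>n. arc_through D (u j t) = A k"
    by (rule strand_arcs[of j]) blast
  define a where "a = c (bridge_arc i)"
  define d where "d = c (bridge_arc (\<not> i)) - a"
  have "[c (A k) = a + d * zigzag k] (mod int p)" if "k \<le> n" for k
  proof (rule alternating_reflections_zigzag[where n = n])
    fix k assume "k < n"
    then have "[2 * c (bridge_arc (if even k then \<not> i else i)) = c (A k) + c (A (Suc k))] (mod int p)"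
      using step assms unfolding coloring_def by blast
    then show "[2 * (if even k then a + d else a) = c (A k) + c (A (Suc k))] (mod int p)"
      by (simp add: a_def d_def split: if_splits)
  qed (use that A0 in \<open>auto simp: a_def\<close>)
  then show ?thesis
    using that[of n A i' i] n An A cover unfolding a_def d_def by blast
qed

text \<open>
  With equal bridge colors the step of the zigzag vanishes, so both under-strands keep the color of
  the bridges throughout; and every arc contains a point of a bridge or of an under-strand.
\<close>

lemma equal_bridge_colors_trivial:
  assumes c: "coloring p D c" and eq: "[c (bridge_arc True) = c (bridge_arc False)] (mod int p)"
    and X: "X \<in> diagram_arcs D"
  shows "[c X = c (bridge_arc True)] (mod int p)"
proof -
  have bridge: "[c (bridge_arc i) = c (bridge_arc True)] (mod int p)" for i
    using eq by (cases i) (auto simp: cong_sym_eq)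
  obtain x where x: "x \<in> D" "x \<notin> under_points D" "X = arc_through D x"
    using X by (auto simp: diagram_arcs_eq)
  show ?thesis
    using point_cases[OF x(1)]
  proof (elim disjE exE bexE)
    fix i s assume "s \<in> {0..1}" "x = b i s"
    then show ?thesis
      using arc_through_bridge bridge x(3) by simp
  next
    fix j t assume t: "t \<in> {0..1}" "x = u j t"
    obtain i i' n A where
      col: "\<And>k. k \<le> n \<Longrightarrow> [c (A k) = c (bridge_arc i)
        + (c (bridge_arc (\<not> i)) - c (bridge_arc i)) * zigzag k] (mod int p)"
      and cover: "\<And>t. t \<in> {0..1} \<Longrightarrow> u j t \<notin> under_points D \<Longrightarrow>
        \<exists>k\<le>n. arc_through D (u j t) = A k"
      by (rule strand_colors[OF c, of j]) blast
    obtain k where k: "k \<le> n" "X = A k"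
      using cover[OF t(1)] x t(2) by auto
    have "[c (bridge_arc (\<not> i)) = c (bridge_arc i)] (mod int p)"
      using bridge[of i] bridge[of "\<not> i"] by (metis cong_sym cong_trans)
    then have "[c (bridge_arc i) + (c (bridge_arc (\<not> i)) - c (bridge_arc i)) * zigzag k
        = c (bridge_arc i)] (mod int p)"
      by (simp add: cong_iff_dvd_diff)
    with col[OF k(1)] bridge[of i] show ?thesis
      unfolding k(2) by (metis cong_trans)
  qed
qed

text \<open>
  Returning to a bridge color takes at least \<open>p - 1\<close> crossings, and the \<open>p\<close> arcs seen up to then carry
  all residues.
\<close>

lemma all_colors_used:
  assumes p: "prime p" "odd p" and c: "nontrivial_coloring p D c"
  shows "\<exists>X\<in>diagram_arcs D. [c X = k] (mod int p)"
proof -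
  have col: "coloring p D c"
    using c by (simp add: nontrivial_coloring_def)
  have ne: "\<not> [c (bridge_arc True) = c (bridge_arc False)] (mod int p)"
    using c equal_bridge_colors_trivial[OF col] unfolding nontrivial_coloring_def
    by (metis cong_sym cong_trans)
  obtain i i' n A where n: "n \<ge> 1" and An: "A n = bridge_arc i'"
    and A: "\<And>k. k \<le> n \<Longrightarrow> A k \<in> diagram_arcs D"
    and zig: "\<And>k. k \<le> n \<Longrightarrow> [c (A k) = c (bridge_arc i)
      + (c (bridge_arc (\<not> i)) - c (bridge_arc i)) * zigzag k] (mod int p)"
    by (rule strand_colors[OF col, of True]) blast
  define a where "a = c (bridge_arc i)"
  define d where "d = c (bridge_arc (\<not> i)) - a"
  note zig = zig[folded a_def, folded d_def]
  have d: "\<not> int p dvd d"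
    using ne by (cases i) (auto simp: a_def d_def cong_iff_dvd_diff dvd_diff_commute)
  have "c (A n) = a \<or> c (A n) = a + d"
    using An by (cases "i' = i") (auto simp: a_def d_def)
  then have "int p dvd d * zigzag n \<or> int p dvd d * (zigzag n - 1)"
    using zig[of n] by (auto simp: cong_iff_dvd_diff dvd_diff_commute algebra_simps)
  then have "int p dvd zigzag n \<or> int p dvd zigzag n - 1"
    using d p(1) by (auto simp: prime_dvd_mult_iff)
  with n have "p \<le> Suc n"
    by (rule zigzag_return_bound)
  obtain m where m: "m < p" "[a + d * zigzag m = k] (mod int p)"
    using progression_through_zigzag[OF p d] .
  then have "m \<le> n"
    using \<open>p \<le> Suc n\<close> by simp
  then show ?thesis
    using A[of m] zig[of m] m(2) by (auto intro: cong_trans)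
qed

end

theorem corollary1p2:
  fixes R D :: "space set" and p :: nat and c :: "space set \<Rightarrow> int"
  assumes "rational_knot R"
    and "prime p" and "odd p" and "knot_determinant R = p"
    and "schubert_normal_form D" and "diagram_of D R"
    and "nontrivial_coloring p D c"
  shows "\<forall>k::int. \<exists>A\<in>diagram_arcs D. [c A = k] (mod int p)"
proof -
  have "\<exists>b u. schubert_picture D b u"
    using \<open>schubert_normal_form D\<close> unfolding schubert_normal_form_def link_diagram_def
    \<comment> \<open>Each locale assumption is an instance of one conjunct; for \<open>first_bridge\<close> the path \<open>g\<close> is \<open>u j\<close>.\<close>
    by (elim conjE exE, intro exI, unfold_locales)
      (assumption
        | drule spec, erule conjunct1 conjunct2
        | drule spec, assumption
        | drule spec, drule spec, assumption
        | erule (1) bspec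
        | drule spec, drule spec, drule bspec, rule insertI1, erule (1) mp)+
  then show ?thesis
    using schubert_picture.all_colors_used assms by blast
qed

end
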